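(* Let $(X,f)$ be a dynamical system with an expansive $\ell$-Markov partition $\mathscr{H}=\{H_i\}$, $\lambda(H_i)<\infty$ for all $i$, whose transition matrix $P$ defines an irreducible, aperiodic, positive recurrent Markov chain. If $E\in\mathscr{L}(X)$ satisfies $\lambda(f(E)\setminus E)=0$, then either $\lambda(E)=0$ or $\lambda(X\setminus E)=0$.
   Context: $\lambda$ is Lebesgue measure and $\mathscr{L}(X)$ is the Lebesgue $\sigma$-algebra on $X$; measurable means Lebesgue measurable. "Linear" means affine. $\ell$-Markov partition: Let $X\subseteq\mathbb{R}$ be a measurable set which is a countable union of closed intervals with non-empty interiors, and $f:X\to X$ measurable. $(X,f)$ has an $\ell$-Markov partition $\mathscr{H}$ if $\mathscr{H}$ is a countable (finite or countably infinite) set of closed subintervals of $\mathbb{R}$ with non-empty interior such that: (1) $\operatorname{int}(A)\cap\operatorname{int}(B)=\emptyset$ for distinct $A,B\in\mathscr{H}$; (2) $X=\bigcup\mathscr{H}$; (3) for all $A\in\mathscr{H}$ there is $\emptyset\ne\mathscr{A}\subseteq\mathscr{H}$ with $\operatorname{int}(f(A))=\operatorname{int}(\bigcup\mathscr{A})$; (4) $f$ is linear on the interior of each $H\in\mathscr{H}$. The elements of $\mathscr{H}$ are enumerated as $H_i$, with $i$ ranging over $\mathbb{Z}^+$ (or over $\{1,\dots,m\}$ if $\mathscr{H}$ has $m<\infty$ elements). For a finite sequence of indices let $H_{i_0\dots i_n}=\bigcap_{k=0}^n f^{-k}(H_{i_k})$. The partition is expansive if for every $\delta>0$ and every bounded interval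 $I\subseteq X$ there are finitely many finite index sequences $(i^{(k)}_0,\dots,i^{(k)}_{n_k})$, $1\le k\le N$, with $\lambda\big(I\,\Delta\,\bigcup_{k=1}^N H_{i^{(k)}_0\dots i^{(k)}_{n_k}}\big)<\delta$, where $\Delta$ denotes symmetric difference. Transition matrix (defined when all $\lambda(H_i)<\infty$): $P=(p_{ij})$ with $p_{ij}=\frac{\lambda(H_j)}{\lambda(H_i)\,|f'(H_i)|}$ if $\operatorname{int}(H_j)\subseteq f(H_i)$ and $p_{ij}=0$ otherwise, where $f'(H_i)$ is the slope of $f$ on $\operatorname{int}(H_i)$. $P$ is row-stochastic and defines a Markov chain on the index set. Positive recurrent means that every state is recurrent (return probability $1$) with finite mean return time. *)

theory Defs
  imports "HOL-Analysis.Analysis"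
begin

section \<open>Piecewise affine Markov maps of the line\<close>

text \<open>A dynamical system \<open>(X, f)\<close> is modelled by a total function on the reals of which only
  the restriction to \<open>X\<close> matters. Closed intervals may be unbounded.\<close>

definition nondeg_closed_interval :: "real set \<Rightarrow> bool" where
  "nondeg_closed_interval A \<longleftrightarrow> is_interval A \<and> closed A \<and> interior A \<noteq> {}"

definition affine_on :: "(real \<Rightarrow> real) \<Rightarrow> real set \<Rightarrow> bool" where
  "affine_on f A \<longleftrightarrow> (\<exists>a b. \<forall>x\<in>A. f x = a * x + b)"

definition interval_system :: "real set \<Rightarrow> (real \<Rightarrow> real) \<Rightarrow> bool" where
  "interval_system X f \<longleftrightarrow>
     X \<in> sets lebesgue \<and>
     (\<exists>\<C>. countable \<C> \<and> (\<forall>J\<in>\<C>. nondeg_closed_interval J) \<and> X = \<Union>\<C>) \<and>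
     f \<in> lebesgue_on X \<rightarrow>\<^sub>M lebesgue_on X"

definition l_markov_partition :: "real set \<Rightarrow> (real \<Rightarrow> real) \<Rightarrow> real set set \<Rightarrow> bool" where
  "l_markov_partition X f \<H> \<longleftrightarrow>
     countable \<H> \<and> (\<forall>A\<in>\<H>. nondeg_closed_interval A) \<and>
     (\<forall>A\<in>\<H>. \<forall>B\<in>\<H>. A \<noteq> B \<longrightarrow> interior A \<inter> interior B = {}) \<and>
     X = \<Union>\<H> \<and>
     (\<forall>A\<in>\<H>. \<exists>\<A>. \<A> \<noteq> {} \<and> \<A> \<subseteq> \<H> \<and> interior (f ` A) = interior (\<Union>\<A>)) \<and>
     (\<forall>A\<in>\<H>. affine_on f (interior A))"

definition enumerates :: "(nat \<Rightarrow> 'a) \<Rightarrow> nat set \<Rightarrow> 'a set \<Rightarrow> bool" where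
  "enumerates H I \<H> \<longleftrightarrow> (I = {1..} \<or> (\<exists>m. I = {1..m})) \<and> bij_betw H I \<H>"

text \<open>A word \<open>i\<^sub>0 \<dots> i\<^sub>n\<close> is a nonempty list of length \<open>n + 1\<close>; preimages are taken within \<open>X\<close>.\<close>

definition cylinder ::
  "real set \<Rightarrow> (real \<Rightarrow> real) \<Rightarrow> (nat \<Rightarrow> real set) \<Rightarrow> nat list \<Rightarrow> real set" where
  "cylinder X f H w = (\<Inter>k\<in>{..<length w}. (f ^^ k) -` H (w ! k) \<inter> X)"

definition expansive ::
  "real set \<Rightarrow> (real \<Rightarrow> real) \<Rightarrow> (nat \<Rightarrow> real set) \<Rightarrow> nat set \<Rightarrow> bool" where
  "expansive X f H I \<longleftrightarrow>
     (\<forall>\<delta>::real. \<delta> > 0 \<longrightarrow> (\<forall>J. is_interval J \<and> bounded J \<and> J \<subseteq> X \<longrightarrow>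
        (\<exists>W. finite W \<and> (\<forall>w\<in>W. w \<noteq> [] \<and> set w \<subseteq> I) \<and>
             emeasure lebesgue (sym_diff J (\<Union>w\<in>W. cylinder X f H w)) < ennreal \<delta>)))"

text \<open>Well defined whenever \<open>f\<close> is affine on \<open>interior A\<close> and \<open>interior A\<close> is nonempty.\<close>

definition slope :: "(real \<Rightarrow> real) \<Rightarrow> real set \<Rightarrow> real" where
  "slope f A = (THE a. \<exists>b. \<forall>x\<in>interior A. f x = a * x + b)"

definition transition_matrix ::
  "(real \<Rightarrow> real) \<Rightarrow> (nat \<Rightarrow> real set) \<Rightarrow> nat \<Rightarrow> nat \<Rightarrow> real" where
  "transition_matrix f H i j =
     (if interior (H j) \<subseteq> f ` H i
      then measure lebesgue (H j) / (measure lebesgue (H i) * \<bar>slope f (H i)\<bar>) else 0)"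

section \<open>Markov chains on a countable state set\<close>

text \<open>The chain with state set \<open>S\<close> and transition matrix \<open>P\<close> is treated through its \<open>n\<close>-step and
  first-passage probabilities. For row-stochastic \<open>P\<close> all the infinite sums below converge.\<close>

primrec n_step :: "'s set \<Rightarrow> ('s \<Rightarrow> 's \<Rightarrow> real) \<Rightarrow> nat \<Rightarrow> 's \<Rightarrow> 's \<Rightarrow> real" where
  "n_step S P 0 i j = (if i = j then 1 else 0)"
| "n_step S P (Suc n) i j = (\<Sum>\<^sub>\<infinity>k\<in>S. P i k * n_step S P n k j)"

text \<open>The probability, starting from \<open>i\<close>, that the first visit to \<open>j\<close> at a positive time happens
  at time \<open>n\<close>.\<close>

fun first_passage :: "'s set \<Rightarrow> ('s \<Rightarrow> 's \<Rightarrow> real) \<Rightarrow> nat \<Rightarrow> 's \<Rightarrow> 's \<Rightarrow> real" where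
  "first_passage S P 0 i j = 0"
| "first_passage S P (Suc 0) i j = P i j"
| "first_passage S P (Suc (Suc n)) i j =
     (\<Sum>\<^sub>\<infinity>k\<in>S - {j}. P i k * first_passage S P (Suc n) k j)"

definition irreducible_chain :: "'s set \<Rightarrow> ('s \<Rightarrow> 's \<Rightarrow> real) \<Rightarrow> bool" where
  "irreducible_chain S P \<longleftrightarrow> (\<forall>i\<in>S. \<forall>j\<in>S. \<exists>n>0. n_step S P n i j > 0)"

definition aperiodic_chain :: "'s set \<Rightarrow> ('s \<Rightarrow> 's \<Rightarrow> real) \<Rightarrow> bool" where
  "aperiodic_chain S P \<longleftrightarrow> (\<forall>i\<in>S. Gcd {n. n > 0 \<and> n_step S P n i i > 0} = 1)"

definition positive_recurrent_chain :: "'s set \<Rightarrow> ('s \<Rightarrow> 's \<Rightarrow> real) \<Rightarrow> bool" where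
  "positive_recurrent_chain S P \<longleftrightarrow>
     (\<forall>i\<in>S. (\<lambda>n. first_passage S P n i i) sums 1 \<and>
            summable (\<lambda>n. real n * first_passage S P n i i))"

end

theory Submission
  imports Defs "HOL-Library.Sublist"
begin

text \<open>Let \<open>d i\<close> be the density of \<open>E\<close> in the cell \<open>H i\<close>. Since \<open>f\<close> is affine on \<open>H i\<close> with image a
  union of cells up to a null set, and \<open>f\<close> maps \<open>E\<close> into itself up to a null set, \<open>d\<close> is subharmonic:
  \<open>d i \<le> (\<Sum>j. p i j * d j)\<close>. Bounded subharmonic functions of an irreducible recurrent chain are
  constant, so \<open>d\<close> is a constant \<open>q\<close>. Likewise \<open>E\<close> has density at most \<open>d j\<close> in every cylinder whose
  word ends in \<open>j\<close>. If \<open>q < 1\<close>, expansiveness transfers the bound \<open>q\<close> to all intervals, then to open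
  sets, and outer regularity makes \<open>E\<close> null. If \<open>q = 1\<close>, the complement of \<open>E\<close> is null.\<close>

section \<open>Recurrent Markov chains\<close>

lemma has_sum_subtract:
  fixes f g :: "'a \<Rightarrow> 'b::topological_ab_group_add"
  assumes "(f has_sum a) A" "(g has_sum b) A"
  shows "((\<lambda>x. f x - g x) has_sum (a - b)) A"
  using has_sum_add[OF assms(1), of "\<lambda>x. - g x" "- b"] assms(2) by (simp add: has_sum_uminus)

locale stochastic_matrix =
  fixes S :: "'s set" and P :: "'s \<Rightarrow> 's \<Rightarrow> real"
  assumes nonneg: "P i j \<ge> 0"
    and row_sum: "i \<in> S \<Longrightarrow> (P i has_sum 1) S"
begin

lemma summable_row_mult:
  assumes "i \<in> S" "T \<subseteq> S" "\<And>k. k \<in> T \<Longrightarrow> 0 \<le> g k" "\<And>k. k \<in> T \<Longrightarrow> g k \<le> 1"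
  shows "(\<lambda>k. P i k * g k) summable_on T"
proof (rule summable_on_comparison_test)
  show "P i summable_on T"
    using row_sum[OF assms(1)] assms(2) has_sum_imp_summable summable_on_subset_banach by blast
qed (use assms nonneg in \<open>auto intro: mult_left_le\<close>)

lemma first_passage_bounds:
  "i \<in> S \<Longrightarrow> j \<in> S \<Longrightarrow> 0 \<le> first_passage S P n i j \<and> first_passage S P n i j \<le> 1"
proof (induction n arbitrary: i rule: less_induct)
  case (less n)
  consider "n = 0" | "n = Suc 0" | m where "n = Suc (Suc m)"
    by (metis not0_implies_Suc)
  then show ?case
  proof cases
    case 2
    have "(P i has_sum (P i j)) {j}"
      using has_sum_finite[of "{j}" "P i"] by simp
    from has_sum_mono_neutral[OF this row_sum[OF less.prems(1)]] have "P i j \<le> 1"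
      using less.prems nonneg by auto
    then show ?thesis using 2 nonneg by simp
  next
    case 3
    have ih: "0 \<le> first_passage S P (Suc m) k j \<and> first_passage S P (Suc m) k j \<le> 1" if "k \<in> S" for k
      using less.IH[of "Suc m"] 3 that less.prems by simp
    have "(\<Sum>\<^sub>\<infinity>k\<in>S - {j}. P i k * first_passage S P (Suc m) k j) \<le> (\<Sum>\<^sub>\<infinity>k\<in>S. P i k)"
    proof (rule infsum_mono_neutral)
      show "(\<lambda>k. P i k * first_passage S P (Suc m) k j) summable_on S - {j}"
        using ih less.prems by (intro summable_row_mult) auto
      show "P i summable_on S"
        using row_sum[OF less.prems(1)] by (rule has_sum_imp_summable)
    qed (use ih nonneg in \<open>auto intro: mult_left_le\<close>)
    also have "\<dots> = 1"
      using row_sum[OF less.prems(1)] by (simp add: infsumI)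
    finally show ?thesis
      using 3 ih nonneg by (auto intro!: infsum_nonneg mult_nonneg_nonneg)
  qed simp
qed

definition hit :: "nat \<Rightarrow> 's \<Rightarrow> 's \<Rightarrow> real" where
  "hit n i j = (\<Sum>m\<le>n. first_passage S P m i j)"

lemma hit_Suc:
  assumes "i \<in> S" "j \<in> S"
  shows "((\<lambda>k. P i k * (if k = j then 1 else hit n k j)) has_sum hit (Suc n) i j) S"
proof (induction n)
  case 0
  have "(P i has_sum (P i j)) {j}"
    using has_sum_finite[of "{j}" "P i"] by simp
  then have "((\<lambda>k. P i k * (if k = j then 1 else 0)) has_sum P i j) S"
    by (subst has_sum_cong_neutral[where T = "{j}" and g = "P i"]) (use assms in auto)
  then show ?case by (simp add: hit_def cong: if_cong)
next
  case (Suc n)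
  have "((\<lambda>k. P i k * first_passage S P (Suc n) k j) has_sum first_passage S P (Suc (Suc n)) i j) (S - {j})"
    using assms first_passage_bounds by (auto intro!: has_sum_infsum summable_row_mult simp del: first_passage.simps(2))
  then have "((\<lambda>k. if k = j then 0 else P i k * first_passage S P (Suc n) k j)
      has_sum first_passage S P (Suc (Suc n)) i j) S"
    by (subst has_sum_cong_neutral[where T = "S - {j}" and g = "\<lambda>k. P i k * first_passage S P (Suc n) k j"]) auto
  from has_sum_add[OF Suc this]
  have "((\<lambda>k. P i k * (if k = j then 1 else hit n k j) +
      (if k = j then 0 else P i k * first_passage S P (Suc n) k j))
      has_sum (hit (Suc n) i j + first_passage S P (Suc (Suc n)) i j)) S" .
  moreover have "P i k * (if k = j then 1 else hit n k j) +
      (if k = j then 0 else P i k * first_passage S P (Suc n) k j) =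
      P i k * (if k = j then 1 else hit (Suc n) k j)" for k
    by (simp add: hit_def algebra_simps)
  moreover have "hit (Suc n) i j + first_passage S P (Suc (Suc n)) i j = hit (Suc (Suc n)) i j"
    by (simp add: hit_def)
  ultimately show ?case by simp
qed

lemma hit_bounds:
  assumes "i \<in> S" "j \<in> S"
  shows "0 \<le> hit n i j" "hit n i j \<le> 1"
proof -
  show "0 \<le> hit n i j"
    unfolding hit_def using assms first_passage_bounds by (intro sum_nonneg) auto
  show "hit n i j \<le> 1"
    using assms(1)
  proof (induction n arbitrary: i)
    case 0
    then show ?case by (simp add: hit_def)
  next
    case (Suc n)
    show ?case
      using Suc nonneg
      by (intro has_sum_mono[OF hit_Suc[OF Suc.prems assms(2)] row_sum]) (auto intro: mult_left_le)
  qed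
qed

lemma hit_tendsto_step:
  assumes "i \<in> S" "j \<in> S" "k \<in> S" "k \<noteq> j" "P i k > 0" "(\<lambda>n. hit n i j) \<longlonglongrightarrow> 1"
  shows "(\<lambda>n. hit n k j) \<longlonglongrightarrow> 1"
proof -
  have le: "P i k * (1 - hit n k j) \<le> 1 - hit (Suc n) i j" for n
  proof -
    have "((\<lambda>l. P i l - P i l * (if l = j then 1 else hit n l j)) has_sum (1 - hit (Suc n) i j)) S"
      by (intro has_sum_subtract row_sum hit_Suc assms)
    moreover have "P i l - P i l * (if l = j then 1 else hit n l j) \<ge> 0" if "l \<in> S" for l
      using that hit_bounds[OF that assms(2), of n] nonneg[of i l] by (auto intro: mult_left_le)
    ultimately have "sum (\<lambda>l. P i l - P i l * (if l = j then 1 else hit n l j)) {k} \<le> 1 - hit (Suc n) i j"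
      using assms(3) by (intro finite_sum_le_has_sum) blast+
    then show ?thesis using assms by (simp add: algebra_simps)
  qed
  have "(\<lambda>n. 1 - (1 - hit (Suc n) i j) / P i k) \<longlonglongrightarrow> 1 - (1 - 1) / P i k"
    using assms(5) by (intro tendsto_intros LIMSEQ_Suc[OF assms(6)]) auto
  then have lim: "(\<lambda>n. 1 - (1 - hit (Suc n) i j) / P i k) \<longlonglongrightarrow> 1" by simp
  have "1 - (1 - hit (Suc n) i j) / P i k \<le> hit n k j" for n
    using le[of n] assms(5) by (simp add: field_simps)
  then show ?thesis
    using hit_bounds[OF assms(3,2)]
    by (intro tendsto_sandwich[OF _ _ lim tendsto_const]) auto
qed

lemma n_step_nonneg: "n_step S P n i j \<ge> 0"
  by (induction n arbitrary: i) (auto intro!: infsum_nonneg mult_nonneg_nonneg nonneg)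

lemma hit_tendsto_reachable:
  assumes "j \<in> S" "(\<lambda>n. hit n j j) \<longlonglongrightarrow> 1"
  shows "n_step S P m i k > 0 \<Longrightarrow> i \<in> S \<Longrightarrow> k \<in> S \<Longrightarrow> (\<lambda>n. hit n i j) \<longlonglongrightarrow> 1
    \<Longrightarrow> (\<lambda>n. hit n k j) \<longlonglongrightarrow> 1"
proof (induction m arbitrary: i)
  case 0
  then show ?case by (auto split: if_splits)
next
  case (Suc m)
  have "\<exists>l\<in>S. P i l * n_step S P m l k \<noteq> 0"
  proof (rule ccontr)
    assume "\<not> ?thesis"
    then have "n_step S P (Suc m) i k = 0" by (auto intro: infsum_0)
    then show False using Suc.prems by simp
  qed
  then obtain l where l: "l \<in> S" "P i l > 0" "n_step S P m l k > 0"
    using nonneg[of i] n_step_nonneg[of m _ k] by (metis less_eq_real_def mult_eq_0_iff)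
  have "(\<lambda>n. hit n l j) \<longlonglongrightarrow> 1"
    using hit_tendsto_step[OF Suc.prems(2) assms(1) l(1) _ l(2) Suc.prems(4)] assms(2) by (cases "l = j") auto
  from Suc.IH[OF l(3,1) Suc.prems(3) this] show ?case .
qed

lemma hit_tendsto_1:
  assumes "irreducible_chain S P" "\<And>i. i \<in> S \<Longrightarrow> (\<lambda>n. first_passage S P n i i) sums 1"
    and "i \<in> S" "j \<in> S"
  shows "(\<lambda>n. hit n i j) \<longlonglongrightarrow> 1"
proof -
  have jj: "(\<lambda>n. hit n j j) \<longlonglongrightarrow> 1"
    using assms(2)[OF assms(4)] by (simp add: hit_def sums_def_le)
  obtain n where "n_step S P n j i > 0"
    using assms unfolding irreducible_chain_def by blast
  from hit_tendsto_reachable[OF assms(4) jj this assms(4,3) jj] show ?thesis .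
qed

text \<open>Stopping the chain at its first visit to \<open>j\<close>, a subharmonic \<open>d \<le> 1\<close> is at most
  \<open>d j\<close> times the probability of having stopped plus the probability of not having stopped.\<close>

lemma subharmonic_constant:
  assumes "irreducible_chain S P" "\<And>i. i \<in> S \<Longrightarrow> (\<lambda>n. first_passage S P n i i) sums 1"
    and d: "\<And>i. i \<in> S \<Longrightarrow> 0 \<le> d i \<and> d i \<le> 1"
    and sub: "\<And>i. i \<in> S \<Longrightarrow> d i \<le> (\<Sum>\<^sub>\<infinity>k\<in>S. P i k * d k)"
    and "i \<in> S" "j \<in> S"
  shows "d i = d j"
proof -
  have le: "d i \<le> d j" if i: "i \<in> S" and j: "j \<in> S" for i j
  proof -
    have bound: "d i \<le> 1 - (1 - d j) * hit n i j" if "i \<in> S" for n i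
      using that
    proof (induction n arbitrary: i)
      case 0
      then show ?case using d by (simp add: hit_def)
    next
      case (Suc n)
      have "((\<lambda>k. P i k * d k) has_sum (\<Sum>\<^sub>\<infinity>k\<in>S. P i k * d k)) S"
        using d Suc.prems by (intro has_sum_infsum summable_row_mult) auto
      moreover have "((\<lambda>k. P i k - (1 - d j) * (P i k * (if k = j then 1 else hit n k j)))
          has_sum (1 - (1 - d j) * hit (Suc n) i j)) S"
        by (intro has_sum_subtract has_sum_cmult_right row_sum hit_Suc Suc.prems j)
      moreover have "P i k * d k \<le> P i k - (1 - d j) * (P i k * (if k = j then 1 else hit n k j))"
        if "k \<in> S" for k
      proof -
        have "d k \<le> 1 - (1 - d j) * (if k = j then 1 else hit n k j)"
          using Suc.IH[OF that] by simp
        from mult_left_mono[OF this nonneg[of i k]] show ?thesis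
          by (simp add: algebra_simps)
      qed
      ultimately have "(\<Sum>\<^sub>\<infinity>k\<in>S. P i k * d k) \<le> 1 - (1 - d j) * hit (Suc n) i j"
        by (rule has_sum_mono)
      then show ?case using sub[OF Suc.prems] by linarith
    qed
    have "(\<lambda>n. 1 - (1 - d j) * hit n i j) \<longlonglongrightarrow> 1 - (1 - d j) * 1"
      by (intro tendsto_intros hit_tendsto_1[OF assms(1,2)] i j)
    then have "d i \<le> 1 - (1 - d j) * 1"
      by (rule LIMSEQ_le_const) (use bound i in auto)
    then show ?thesis by simp
  qed
  show ?thesis using le assms(5,6) by (meson antisym)
qed

end

section \<open>Lebesgue measure on the line\<close>

lemma finite_Diff_interior_interval:
  fixes S :: "real set"
  assumes "is_interval S"
  shows "finite (S - interior S)"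
proof -
  have sub: "S - interior S \<subseteq> {x\<in>S. \<forall>y\<in>S. x \<le> y} \<union> {x\<in>S. \<forall>y\<in>S. y \<le> x}"
  proof (rule ccontr)
    assume "\<not> ?thesis"
    then obtain x where x: "x \<in> S" "x \<notin> interior S"
      and "\<not> (\<forall>y\<in>S. x \<le> y)" "\<not> (\<forall>y\<in>S. y \<le> x)"
      by blast
    then obtain y z where "y \<in> S" "y < x" "z \<in> S" "x < z"
      by (auto simp: not_le)
    then have "{y<..<z} \<subseteq> S"
      using mem_is_interval_1_I[OF assms \<open>y \<in> S\<close> \<open>z \<in> S\<close>] by (auto simp: less_imp_le)
    then have "x \<in> interior S"
      using \<open>y < x\<close> \<open>x < z\<close> by (intro interiorI[of "{y<..<z}"]) auto
    then show False using x by simp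
  qed
  have fin: "finite T" if "\<And>x y. x \<in> T \<Longrightarrow> y \<in> T \<Longrightarrow> x = y" for T :: "real set"
  proof (cases "T = {}")
    case False
    then obtain x where "x \<in> T" by blast
    then have "T \<subseteq> {x}" using that by blast
    then show ?thesis using finite_subset by blast
  qed simp
  have "finite {x\<in>S. \<forall>y\<in>S. x \<le> y}"
    by (rule fin) (simp add: antisym)
  moreover have "finite {x\<in>S. \<forall>y\<in>S. y \<le> x}"
    by (rule fin) (simp add: antisym)
  ultimately show ?thesis
    using sub by (meson finite_UnI finite_subset)
qed

lemma negligible_countable:
  fixes S :: "'a::euclidean_space set"
  assumes "countable S"
  shows "negligible S"
proof -
  have "negligible (\<Union>x\<in>S. {x})"
    using assms by (intro negligible_countable_Union) auto
  then show ?thesis by simp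
qed

lemma interior_finite:
  fixes S :: "'a::euclidean_space set"
  assumes "finite S"
  shows "interior S = {}"
  using open_not_negligible[of "interior S"]
    negligible_subset[OF negligible_finite[OF assms] interior_subset] by auto

lemma affine_image_lebesgue:
  fixes S :: "real set"
  assumes "S \<in> sets lebesgue" "\<And>x. x \<in> S \<Longrightarrow> f x = a * x + c"
  shows "f ` S \<in> sets lebesgue"
    and "emeasure lebesgue (f ` S) = ennreal \<bar>a\<bar> * emeasure lebesgue S"
    and "measure lebesgue (f ` S) = \<bar>a\<bar> * measure lebesgue S"
proof -
  have eq: "f ` S = (\<lambda>x. a *\<^sub>R x + c) ` S"
    using assms(2) by (intro image_cong) auto
  show "f ` S \<in> sets lebesgue"
    unfolding eq using assms(1)
    by (intro differentiable_image_in_sets_lebesgue) (auto intro!: derivative_intros)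
  show "emeasure lebesgue (f ` S) = ennreal \<bar>a\<bar> * emeasure lebesgue S"
    unfolding eq emeasure_lebesgue_affine by simp
  show "measure lebesgue (f ` S) = \<bar>a\<bar> * measure lebesgue S"
    unfolding eq measure_lebesgue_affine by simp
qed

lemma negligible_affine_vimage:
  fixes a c :: real
  assumes "negligible N" "a \<noteq> 0"
  shows "negligible {x. a * x + c \<in> N}"
proof -
  have eq: "{x. a * x + c \<in> N} = (\<lambda>y. (y - c) / a) ` N"
    using assms(2) by (auto simp: image_iff field_simps intro!: bexI[of _ "a * _ + c"])
  have N: "N \<in> null_sets lebesgue"
    using assms(1) by (simp add: negligible_iff_null_sets)
  then have "(\<lambda>y. (y - c) / a) ` N \<in> null_sets lebesgue"
    using affine_image_lebesgue[of N "\<lambda>y. (y - c) / a" "1 / a" "- c / a"]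
    by (auto simp: null_sets_def diff_divide_distrib)
  then show ?thesis unfolding eq negligible_iff_null_sets .
qed

lemma measure_le_mod_negligible:
  assumes "A \<in> sets lebesgue" "B \<in> lmeasurable" "negligible (A - B)"
  shows "measure lebesgue A \<le> measure lebesgue B"
proof -
  have N: "A - B \<in> null_sets lebesgue"
    using assms(3) by (simp add: negligible_iff_null_sets)
  have "measure lebesgue A \<le> measure lebesgue (B \<union> (A - B))"
    using assms(1,2) fmeasurableI_null_sets[OF N]
    by (intro measure_mono_fmeasurable fmeasurable.Un) auto
  also have "\<dots> = measure lebesgue B"
    using N assms(2) by (intro measure_Un_null_set) auto
  finally show ?thesis .
qed

lemma measure_eq_mod_negligible:
  assumes "A \<in> sets lebesgue" "B \<in> sets lebesgue" "negligible (A - B)" "negligible (B - A)"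
  shows "measure lebesgue A = measure lebesgue B"
proof (rule measure_eq_AE)
  have "AE x in lebesgue. x \<notin> A - B"
    using assms(3) unfolding negligible_iff_null_sets by (rule AE_not_in)
  moreover have "AE x in lebesgue. x \<notin> B - A"
    using assms(4) unfolding negligible_iff_null_sets by (rule AE_not_in)
  ultimately show "AE x in lebesgue. x \<in> A \<longleftrightarrow> x \<in> B"
    by eventually_elim auto
qed (use assms in auto)

lemma bounded_interval_finite_measure:
  fixes S :: "real set"
  assumes "is_interval S" "S \<in> lmeasurable"
  shows "bounded S"
proof (cases "S = {}")
  case False
  then obtain x where x: "x \<in> S" by blast
  have "dist x y \<le> measure lebesgue S" if y: "y \<in> S" for y
  proof -
    have sub: "{min x y..max x y} \<subseteq> S"
      using mem_is_interval_1_I[OF assms(1), of "min x y" "max x y"] x y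
      by (auto simp: min_def max_def split: if_splits)
    have "dist x y = measure lebesgue {min x y..max x y}"
      by (auto simp: dist_real_def min_def max_def)
    also have "\<dots> \<le> measure lebesgue S"
      using sub assms(2) by (intro measure_mono_fmeasurable) auto
    finally show ?thesis .
  qed
  then show ?thesis by (auto simp: bounded_def)
qed simp

section \<open>Markov partitions\<close>

locale markov_system =
  fixes X :: "real set" and f :: "real \<Rightarrow> real" and \<H> :: "real set set"
    and H :: "nat \<Rightarrow> real set" and I :: "nat set"
  assumes system: "interval_system X f"
    and partition: "l_markov_partition X f \<H>"
    and enum: "enumerates H I \<H>"
    and finite_measure: "i \<in> I \<Longrightarrow> emeasure lebesgue (H i) < \<infinity>"
begin

abbreviation "core i \<equiv> interior (H i)"

lemma bij: "bij_betw H I \<H>"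
  using enum by (simp add: enumerates_def)

lemma H_in: "i \<in> I \<Longrightarrow> H i \<in> \<H>"
  using bij bij_betwE by blast

lemma nondeg: "i \<in> I \<Longrightarrow> nondeg_closed_interval (H i)"
  using partition H_in by (auto simp: l_markov_partition_def)

lemma X_eq: "X = (\<Union>i\<in>I. H i)"
  using partition bij by (auto simp: l_markov_partition_def bij_betw_def)

lemma H_subset_X: "i \<in> I \<Longrightarrow> H i \<subseteq> X"
  using X_eq by auto

lemma core_subset: "core i \<subseteq> H i"
  by (rule interior_subset)

lemma core_ne: "i \<in> I \<Longrightarrow> core i \<noteq> {}"
  using nondeg by (auto simp: nondeg_closed_interval_def)

lemma H_lmeasurable: "i \<in> I \<Longrightarrow> H i \<in> lmeasurable"
  using nondeg[of i] finite_measure[of i] by (auto simp: nondeg_closed_interval_def fmeasurable_def)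

lemma core_lmeasurable: "i \<in> I \<Longrightarrow> core i \<in> lmeasurable"
  using fmeasurableI2[OF H_lmeasurable core_subset] by auto

lemma core_sets: "core i \<in> sets lebesgue"
  by simp

lemma X_sets: "X \<in> sets lebesgue"
  using system by (simp add: interval_system_def)

lemma f_in_X: "x \<in> X \<Longrightarrow> f x \<in> X"
  using system measurable_space[of f "lebesgue_on X" "lebesgue_on X" x]
  by (auto simp: interval_system_def)

lemma vimage_sets:
  assumes "Q \<in> sets lebesgue"
  shows "f -` Q \<inter> X \<in> sets lebesgue"
proof -
  have "f -` (Q \<inter> X) \<inter> space (lebesgue_on X) \<in> sets (lebesgue_on X)"
    using system assms X_sets
    by (intro measurable_sets[of f _ "lebesgue_on X"]) (auto simp: interval_system_def sets_restrict_space_iff)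
  moreover have "f -` (Q \<inter> X) \<inter> space (lebesgue_on X) = f -` Q \<inter> X"
    using f_in_X by auto
  ultimately show ?thesis
    using X_sets by (simp add: sets_restrict_space_iff)
qed

lemma finite_edge: "i \<in> I \<Longrightarrow> finite (H i - core i)"
  using nondeg[of i] by (auto simp: nondeg_closed_interval_def intro: finite_Diff_interior_interval)

lemma countable_edges: "countable (\<Union>i\<in>I. H i - core i)"
  by (intro countable_UN) (auto simp: finite_edge intro: countable_finite)

lemma core_disjoint:
  assumes "i \<in> I" "j \<in> I" "i \<noteq> j"
  shows "core i \<inter> core j = {}"
proof -
  have "H i \<noteq> H j"
    using bij assms by (auto simp: bij_betw_def inj_on_def)
  then show ?thesis
    using partition H_in assms unfolding l_markov_partition_def by metis
qed

lemma finite_H_Int: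
  assumes "i \<in> I" "j \<in> I" "i \<noteq> j"
  shows "finite (H i \<inter> H j)"
  using core_disjoint[OF assms]
  by (intro finite_subset[of "H i \<inter> H j" "(H i - core i) \<union> (H j - core j)"])
    (auto simp: finite_edge assms)

abbreviation "s i \<equiv> slope f (H i)"

lemma affine_core:
  assumes "i \<in> I"
  obtains c where "\<And>x. x \<in> core i \<Longrightarrow> f x = s i * x + c"
proof -
  have "affine_on f (core i)"
    using partition H_in[OF assms] by (auto simp: l_markov_partition_def)
  then obtain a b where ab: "\<forall>x\<in>core i. f x = a * x + b"
    by (auto simp: affine_on_def)
  obtain x where x: "x \<in> core i"
    using core_ne[OF assms] by auto
  obtain e where e: "e > 0" "ball x e \<subseteq> core i"
    using x open_contains_ball[of "core i"] by auto
  define y where "y = x + e / 2"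
  have y: "y \<in> core i" "y \<noteq> x"
    using e by (auto simp: y_def dist_real_def)
  have "s i = a"
    unfolding slope_def
  proof (rule the_equality)
    show "\<exists>b. \<forall>x\<in>core i. f x = a * x + b" using ab by blast
  next
    fix a' assume "\<exists>b. \<forall>x\<in>core i. f x = a' * x + b"
    then obtain b' where "\<forall>x\<in>core i. f x = a' * x + b'" by blast
    then have "a' * x + b' = a * x + b" "a' * y + b' = a * y + b"
      using ab x y by auto
    then have "(a' - a) * (y - x) = 0" by (simp add: algebra_simps)
    then show "a' = a" using y by simp
  qed
  then show ?thesis using ab that by blast
qed

lemma markov_image:
  assumes "i \<in> I"
  obtains \<A> where "\<A> \<noteq> {}" "\<A> \<subseteq> I" "interior (f ` H i) = interior (\<Union>j\<in>\<A>. H j)"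
proof -
  have "\<forall>A\<in>\<H>. \<exists>\<A>. \<A> \<noteq> {} \<and> \<A> \<subseteq> \<H> \<and> interior (f ` A) = interior (\<Union>\<A>)"
    using partition unfolding l_markov_partition_def by (elim conjE)
  from bspec[OF this H_in[OF assms]]
  obtain \<B> where B: "\<B> \<noteq> {}" "\<B> \<subseteq> \<H>" "interior (f ` H i) = interior (\<Union>\<B>)"
    by (elim exE conjE)
  define \<A> where "\<A> = {j\<in>I. H j \<in> \<B>}"
  have "H ` \<A> = \<B>"
    using B(2) bij by (auto simp: \<A>_def bij_betw_def)
  then have "\<A> \<noteq> {}" "(\<Union>j\<in>\<A>. H j) = \<Union>\<B>"
    using B(1) by auto
  then show ?thesis
    using B(3) that[of \<A>] by (simp add: \<A>_def)
qed

lemma image_edge_finite: "i \<in> I \<Longrightarrow> finite (f ` (H i - core i))"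
  by (simp add: finite_edge)

lemma slope_nonzero:
  assumes "i \<in> I"
  shows "s i \<noteq> 0"
proof
  assume 0: "s i = 0"
  obtain c where "\<And>x. x \<in> core i \<Longrightarrow> f x = s i * x + c"
    using affine_core[OF assms] by blast
  then have "f ` H i \<subseteq> {c} \<union> f ` (H i - core i)"
    using 0 by auto
  then have "finite (f ` H i)"
    using image_edge_finite[OF assms] by (meson finite.emptyI finite_Un finite_insert finite_subset)
  then have "interior (f ` H i) = {}"
    by (rule interior_finite)
  moreover obtain \<A> where A: "\<A> \<noteq> {}" "\<A> \<subseteq> I" "interior (f ` H i) = interior (\<Union>j\<in>\<A>. H j)"
    using markov_image[OF assms] .
  moreover obtain j where "j \<in> \<A>" using A(1) by blast
  then have "core j \<noteq> {}" "core j \<subseteq> interior (\<Union>j\<in>\<A>. H j)"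
    using A(2) core_ne by (auto intro!: interior_mono)
  ultimately show False by simp
qed

lemma image_core:
  assumes "i \<in> I" "Y \<in> sets lebesgue" "Y \<subseteq> core i"
  shows "f ` Y \<in> lmeasurable" "measure lebesgue (f ` Y) = \<bar>s i\<bar> * measure lebesgue Y"
proof -
  obtain c where c: "\<And>x. x \<in> core i \<Longrightarrow> f x = s i * x + c"
    using affine_core[OF assms(1)] by blast
  have Y: "Y \<in> lmeasurable"
    using fmeasurableI2[OF core_lmeasurable[OF assms(1)] assms(3,2)] .
  note im = affine_image_lebesgue[OF assms(2), of f "s i" c]
  show "measure lebesgue (f ` Y) = \<bar>s i\<bar> * measure lebesgue Y"
    using im(3) c assms(3) by blast
  have "f ` Y \<in> sets lebesgue" "emeasure lebesgue (f ` Y) = ennreal \<bar>s i\<bar> * emeasure lebesgue Y"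
    using im(1,2) c assms(3) by blast+
  then show "f ` Y \<in> lmeasurable"
    using Y by (auto simp: fmeasurable_def ennreal_mult_less_top)
qed

lemma open_image_core:
  assumes "i \<in> I"
  shows "open (f ` core i)"
proof -
  obtain c where "\<And>x. x \<in> core i \<Longrightarrow> f x = s i * x + c"
    using affine_core[OF assms] by blast
  then have "f ` core i = (\<lambda>x. c + s i *\<^sub>R x) ` core i"
    by (intro image_cong) auto
  then show ?thesis
    using open_affinity[of "core i" "s i" c] slope_nonzero[OF assms] by simp
qed

lemma negligible_Diff_image_core:
  assumes "i \<in> I" "j \<in> I" "core j \<subseteq> f ` H i"
  shows "negligible (H j - f ` core i)"
proof -
  have "H j - f ` core i \<subseteq> (H j - core j) \<union> f ` (H i - core i)"
    using assms(3) by auto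
  then show ?thesis
    using finite_edge[OF assms(2)] image_edge_finite[OF assms(1)]
    by (meson finite_Un finite_subset negligible_finite)
qed

lemma negligible_Int_image_core:
  assumes "i \<in> I" "j \<in> I" "\<not> core j \<subseteq> f ` H i"
  shows "negligible (H j \<inter> f ` core i)"
proof -
  obtain \<A> where A: "\<A> \<subseteq> I" "interior (f ` H i) = interior (\<Union>j\<in>\<A>. H j)"
    using markov_image[OF assms(1)] by metis
  have "f ` core i \<subseteq> interior (f ` H i)"
    by (intro interior_maximal image_mono core_subset open_image_core assms)
  also have "\<dots> \<subseteq> (\<Union>j\<in>\<A>. H j)"
    unfolding A(2) by (rule interior_subset)
  finally have sub: "f ` core i \<subseteq> (\<Union>j\<in>\<A>. H j)" .
  have "j \<notin> \<A>"
  proof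
    assume "j \<in> \<A>"
    then have "core j \<subseteq> interior (f ` H i)"
      unfolding A(2) by (intro interior_mono) auto
    then show False
      using assms(3) interior_subset[of "f ` H i"] by auto
  qed
  then have "countable (\<Union>k\<in>\<A>. H j \<inter> H k)"
    using A(1) assms(2) by (intro countable_UN) (auto intro!: countable_finite finite_H_Int)
  then have "negligible (\<Union>k\<in>\<A>. H j \<inter> H k)"
    by (rule negligible_countable)
  then show ?thesis
    by (rule negligible_subset) (use sub in auto)
qed

lemma negligible_vimage:
  assumes "negligible N"
  shows "negligible (f -` N \<inter> X)"
proof -
  have "\<forall>i\<in>I. \<exists>c. \<forall>x\<in>core i. f x = s i * x + c"
    using affine_core by metis
  then obtain c where c: "\<And>i x. i \<in> I \<Longrightarrow> x \<in> core i \<Longrightarrow> f x = s i * x + c i"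
    by metis
  have "f -` N \<inter> X \<subseteq> (\<Union>i\<in>I. H i - core i) \<union> (\<Union>i\<in>I. {x. s i * x + c i \<in> N})"
    using c by (fastforce simp: X_eq)
  moreover have "negligible (\<Union>i\<in>I. {x. s i * x + c i \<in> N})"
    using negligible_affine_vimage[OF assms] slope_nonzero
    by (intro negligible_countable_Union) auto
  ultimately show ?thesis
    using negligible_countable[OF countable_edges] by (meson negligible_Un negligible_subset)
qed

lemma measure_has_sum_cells:
  assumes "S \<in> lmeasurable" "S \<subseteq> X"
  shows "((\<lambda>j. measure lebesgue (S \<inter> H j)) has_sum measure lebesgue S) I"
proof -
  define B where "B j = (if j \<in> I then S \<inter> core j else {})" for j
  have UB: "(\<Union>j. B j) \<subseteq> S" by (auto simp: B_def)
  have B: "B j \<in> sets lebesgue" for j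
    using assms(1) by (auto simp: B_def)
  have "disjoint_family B"
    using core_disjoint by (auto simp: disjoint_family_on_def B_def)
  moreover have "(\<Union>j. B j) \<in> lmeasurable"
    using B by (intro fmeasurableI2[OF assms(1) UB]) auto
  ultimately have "(\<lambda>j. measure lebesgue (B j)) sums measure lebesgue (\<Union>j. B j)"
    using B by (intro measure_UNION) (auto simp: fmeasurable_def)
  then have "((\<lambda>j. measure lebesgue (B j)) has_sum measure lebesgue (\<Union>j. B j)) UNIV"
    by (rule sums_nonneg_imp_has_sum) simp
  moreover have "measure lebesgue (\<Union>j. B j) = measure lebesgue S"
  proof (rule measure_eq_mod_negligible)
    have "S - (\<Union>j. B j) \<subseteq> (\<Union>i\<in>I. H i - core i)"
      using assms(2) by (auto simp: X_eq B_def)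
    then show "negligible (S - (\<Union>j. B j))"
      using negligible_countable[OF countable_edges] negligible_subset by blast
    show "negligible ((\<Union>j. B j) - S)"
      using UB by (simp add: Diff_eq_empty_iff[THEN iffD2])
  qed (use B assms in auto)
  moreover have "measure lebesgue (B j) = measure lebesgue (S \<inter> H j)" if "j \<in> I" for j
  proof (rule measure_eq_mod_negligible)
    show "negligible (S \<inter> H j - B j)"
      using that finite_edge[OF that]
      by (intro negligible_subset[OF negligible_finite, of "H j - core j"]) (auto simp: B_def)
    have "B j - S \<inter> H j = {}"
      using core_subset by (auto simp: B_def)
    then show "negligible (B j - S \<inter> H j)" by simp
  qed (use B assms H_lmeasurable[OF that] in auto)
  ultimately show ?thesis
    by (subst has_sum_cong_neutral[where T = UNIV and g = "\<lambda>j. measure lebesgue (B j)"])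
      (auto simp: B_def)
qed

lemma measure_core: "i \<in> I \<Longrightarrow> measure lebesgue (core i) = measure lebesgue (H i)"
  using finite_edge[of i] H_lmeasurable[of i] core_subset[of i]
  by (intro measure_eq_mod_negligible) (auto simp: Diff_eq_empty_iff[THEN iffD2])

lemma measure_H_pos: "i \<in> I \<Longrightarrow> measure lebesgue (H i) > 0"
  using core_ne[of i] open_not_negligible[of "core i"] core_lmeasurable[of i]
  by (simp add: measure_core[symmetric] negligible_iff_measure zero_less_measure_iff)

lemma image_core_subset: "i \<in> I \<Longrightarrow> f ` core i \<subseteq> X"
  using core_subset H_subset_X f_in_X by blast

lemma image_core_lmeasurable: "i \<in> I \<Longrightarrow> f ` core i \<in> lmeasurable"
  by (rule image_core) auto

lemma measure_image_core: "i \<in> I \<Longrightarrow> measure lebesgue (f ` core i) = \<bar>s i\<bar> * measure lebesgue (H i)"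
  using image_core(2)[of i "core i"] measure_core[of i] by (metis core_sets order_refl)

lemma transition_matrix_eq:
  assumes "i \<in> I" "j \<in> I"
  shows "transition_matrix f H i j = measure lebesgue (f ` core i \<inter> H j) / measure lebesgue (f ` core i)"
proof (cases "core j \<subseteq> f ` H i")
  case True
  have "H j - f ` core i \<inter> H j = H j - f ` core i" by auto
  then have "measure lebesgue (f ` core i \<inter> H j) = measure lebesgue (H j)"
    using H_lmeasurable[OF assms(2)] image_core_lmeasurable[OF assms(1)]
      negligible_Diff_image_core[OF assms True]
    by (intro measure_eq_mod_negligible) (auto simp: Diff_eq_empty_iff[THEN iffD2])
  then show ?thesis
    using True measure_image_core[OF assms(1)] by (simp add: transition_matrix_def mult.commute)
next
  case False
  have "measure lebesgue (f ` core i \<inter> H j) = 0"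
    using negligible_Int_image_core[OF assms False] negligible_imp_measure0 by (simp add: Int_commute)
  then show ?thesis
    using False by (simp add: transition_matrix_def)
qed

lemma measure_image_core_pos: "i \<in> I \<Longrightarrow> measure lebesgue (f ` core i) > 0"
  using measure_H_pos slope_nonzero by (simp add: measure_image_core)

lemma stochastic_transition_matrix: "stochastic_matrix I (transition_matrix f H)"
proof
  show "0 \<le> transition_matrix f H i j" for i j
    by (simp add: transition_matrix_def)
next
  fix i assume i: "i \<in> I"
  have "((\<lambda>j. measure lebesgue (f ` core i \<inter> H j) * inverse (measure lebesgue (f ` core i)))
     has_sum (measure lebesgue (f ` core i) * inverse (measure lebesgue (f ` core i)))) I"
    by (intro has_sum_cmult_left measure_has_sum_cells image_core_lmeasurable image_core_subset i)
  then show "(transition_matrix f H i has_sum 1) I"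
    using measure_image_core_pos[OF i]
    by (subst has_sum_cong[OF transition_matrix_eq[OF i]]) (auto simp: divide_inverse)
qed

subsection \<open>Cylinders\<close>

lemma cylinder_iff:
  "w \<noteq> [] \<Longrightarrow> x \<in> cylinder X f H w \<longleftrightarrow> x \<in> X \<and> (\<forall>k<length w. (f ^^ k) x \<in> H (w ! k))"
  by (auto simp: cylinder_def)

lemma cylinder_Cons:
  assumes "w \<noteq> []"
  shows "cylinder X f H (i # w) = H i \<inter> (f -` cylinder X f H w \<inter> X)"
proof -
  have "x \<in> cylinder X f H (i # w) \<longleftrightarrow> x \<in> H i \<inter> (f -` cylinder X f H w \<inter> X)" for x
    using assms f_in_X[of x] by (auto simp: cylinder_iff All_less_Suc2 funpow_swap1)
  then show ?thesis by blast
qed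

lemma cylinder_single: "i \<in> I \<Longrightarrow> cylinder X f H [i] = H i"
  using H_subset_X by (auto simp: cylinder_def)

lemma cylinder_subset_hd: "w \<noteq> [] \<Longrightarrow> cylinder X f H w \<subseteq> H (hd w)"
  by (auto simp: cylinder_iff hd_conv_nth elim!: allE[of _ 0])

lemma cylinder_sets:
  "w \<noteq> [] \<Longrightarrow> set w \<subseteq> I \<Longrightarrow> cylinder X f H w \<in> sets lebesgue"
proof (induction w)
  case (Cons i w)
  have "H i \<in> sets lebesgue"
    using Cons.prems H_lmeasurable[of i] by auto
  moreover have "f -` cylinder X f H w \<inter> X \<in> sets lebesgue" if "w \<noteq> []"
    using Cons that by (intro vimage_sets) auto
  ultimately show ?case
    using Cons.prems by (cases "w = []") (simp_all add: cylinder_single cylinder_Cons)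
qed simp

lemma cylinder_lmeasurable:
  assumes "w \<noteq> []" "set w \<subseteq> I"
  shows "cylinder X f H w \<in> lmeasurable"
  using assms hd_in_set[OF assms(1)]
  by (intro fmeasurableI2[OF H_lmeasurable cylinder_subset_hd cylinder_sets]) auto

lemma cylinder_prefix:
  assumes "w \<noteq> []" "prefix w v"
  shows "cylinder X f H v \<subseteq> cylinder X f H w"
proof -
  obtain u where v: "v = w @ u"
    using assms(2) by (auto simp: prefix_def)
  then have "v ! k = w ! k" "k < length v" if "k < length w" for k
    using that by (simp_all add: nth_append)
  moreover have "v \<noteq> []"
    using v assms(1) by simp
  ultimately show ?thesis
    using assms(1) by (metis cylinder_iff subsetI)
qed

lemma negligible_cylinder_Int:
  assumes "set w \<subseteq> I" "set v \<subseteq> I" "\<not> prefix w v" "\<not> prefix v w"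
  shows "negligible (cylinder X f H w \<inter> cylinder X f H v)"
  using assms
proof (induction w arbitrary: v)
  case (Cons i w)
  then obtain j v' where v: "v = j # v'" by (cases v) auto
  show ?case
  proof (cases "i = j")
    case False
    then have "finite (H i \<inter> H j)"
      using Cons.prems v by (intro finite_H_Int) auto
    then have "negligible (H i \<inter> H j)" by (rule negligible_finite)
    then show ?thesis
      by (rule negligible_subset)
        (use cylinder_subset_hd[of "i # w"] cylinder_subset_hd[of v] v in auto)
  next
    case True
    then have neg: "negligible (cylinder X f H w \<inter> cylinder X f H v')" and ne: "w \<noteq> []" "v' \<noteq> []"
      using Cons v by auto
    from negligible_vimage[OF neg] show ?thesis
      by (rule negligible_subset) (auto simp: v cylinder_Cons ne)
  qed
qed simp

end

section \<open>Forward invariant sets\<close>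

locale forward_invariant_set = markov_system +
  fixes E :: "real set"
  assumes E_sets: "E \<in> sets lebesgue"
    and E_subset: "E \<subseteq> X"
    and invariant: "negligible (f ` E - E)"
begin

definition cell_density :: "nat \<Rightarrow> real" where
  "cell_density i = measure lebesgue (E \<inter> H i) / measure lebesgue (H i)"

lemma E_Int_lmeasurable: "S \<in> lmeasurable \<Longrightarrow> E \<inter> S \<in> lmeasurable"
  using E_sets by (intro fmeasurableI2[of S lebesgue "E \<inter> S"]) auto

lemma cell_density_mult: "i \<in> I \<Longrightarrow> cell_density i * measure lebesgue (H i) = measure lebesgue (E \<inter> H i)"
  using measure_H_pos[of i] by (simp add: cell_density_def)

lemma cell_density_bounds:
  assumes "i \<in> I"
  shows "0 \<le> cell_density i" "cell_density i \<le> 1"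
proof -
  have "measure lebesgue (E \<inter> H i) \<le> measure lebesgue (H i)"
    using E_sets H_lmeasurable[OF assms] by (intro measure_mono_fmeasurable) auto
  then show "0 \<le> cell_density i" "cell_density i \<le> 1"
    using measure_H_pos[OF assms] by (auto simp: cell_density_def)
qed

text \<open>Up to a null set \<open>f ` core i\<close> either contains the cell \<open>H j\<close> or misses it, so that intersecting
  a part \<open>Q\<close> of the cell with \<open>f ` core i\<close> preserves any bound on the density of \<open>E\<close> in \<open>Q\<close>.\<close>

lemma measure_image_Int_le:
  assumes "i \<in> I" "j \<in> I" "Q \<in> sets lebesgue" "Q \<subseteq> H j"
    and q: "q \<ge> 0" "measure lebesgue (E \<inter> Q) \<le> q * measure lebesgue Q"
  shows "measure lebesgue (f ` (E \<inter> core i) \<inter> Q) \<le> q * measure lebesgue (f ` core i \<inter> Q)"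
proof -
  have Q: "Q \<in> lmeasurable"
    using fmeasurableI2[OF H_lmeasurable[OF assms(2)] assms(4,3)] .
  have T: "f ` core i \<in> sets lebesgue" "f ` (E \<inter> core i) \<in> sets lebesgue"
    by (intro fmeasurableD image_core(1)[OF assms(1)] sets.Int core_sets E_sets; blast)+
  show ?thesis
  proof (cases "core j \<subseteq> f ` H i")
    case True
    have "negligible (f ` (E \<inter> core i) \<inter> Q - E \<inter> Q)"
      by (rule negligible_subset[OF invariant]) blast
    then have "measure lebesgue (f ` (E \<inter> core i) \<inter> Q) \<le> measure lebesgue (E \<inter> Q)"
      using T(2) assms(3) E_Int_lmeasurable[OF Q]
      by (intro measure_le_mod_negligible sets.Int)
    moreover have "measure lebesgue (f ` core i \<inter> Q) = measure lebesgue Q"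
    proof (rule measure_eq_mod_negligible)
      show "negligible (Q - f ` core i \<inter> Q)"
        by (rule negligible_subset[OF negligible_Diff_image_core[OF assms(1,2) True]]) (use assms(4) in blast)
      have "f ` core i \<inter> Q - Q = {}" by blast
      then show "negligible (f ` core i \<inter> Q - Q)" by simp
      show "f ` core i \<inter> Q \<in> sets lebesgue"
        using T(1) assms(3) by (rule sets.Int)
    qed (rule assms(3))
    ultimately show ?thesis
      using q(2) by simp
  next
    case False
    have "negligible (f ` (E \<inter> core i) \<inter> Q)"
      by (rule negligible_subset[OF negligible_Int_image_core[OF assms(1,2) False]]) (use assms(4) in blast)
    then show ?thesis
      using q(1) by (simp only: negligible_imp_measure0) simp
  qed
qed

lemma measure_E_core:
  assumes "i \<in> I"
  shows "measure lebesgue (E \<inter> core i) = measure lebesgue (E \<inter> H i)"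
proof (rule measure_eq_mod_negligible)
  have "E \<inter> core i - E \<inter> H i = {}"
    using core_subset by auto
  then show "negligible (E \<inter> core i - E \<inter> H i)" by simp
  show "negligible (E \<inter> H i - E \<inter> core i)"
    by (rule negligible_subset[OF negligible_finite[OF finite_edge[OF assms]]]) auto
qed (use E_sets H_lmeasurable[OF assms] in auto)

lemma measure_image_E_core:
  assumes "i \<in> I"
  shows "measure lebesgue (f ` (E \<inter> core i)) = \<bar>s i\<bar> * measure lebesgue (E \<inter> H i)"
  using image_core(2)[OF assms, of "E \<inter> core i"] E_sets core_sets measure_E_core[OF assms] by simp

lemma cell_density_subharmonic:
  assumes "i \<in> I"
  shows "cell_density i \<le> (\<Sum>\<^sub>\<infinity>j\<in>I. transition_matrix f H i j * cell_density j)"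
proof -
  interpret stochastic_matrix I "transition_matrix f H"
    by (rule stochastic_transition_matrix)
  have T: "f ` (E \<inter> core i) \<in> lmeasurable"
    using E_sets assms by (intro image_core) auto
  have "f ` (E \<inter> core i) \<subseteq> X"
    using image_core_subset[OF assms] by auto
  from has_sum_cmult_left[OF measure_has_sum_cells[OF T this], of "inverse (measure lebesgue (f ` core i))"]
  have "((\<lambda>j. measure lebesgue (f ` (E \<inter> core i) \<inter> H j) * inverse (measure lebesgue (f ` core i)))
      has_sum (measure lebesgue (f ` (E \<inter> core i)) * inverse (measure lebesgue (f ` core i)))) I" .
  moreover have "measure lebesgue (f ` (E \<inter> core i)) * inverse (measure lebesgue (f ` core i)) = cell_density i"
    using slope_nonzero[OF assms]
    by (simp add: measure_image_E_core[OF assms] measure_image_core[OF assms] cell_density_def divide_inverse)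
  ultimately have "((\<lambda>j. measure lebesgue (f ` (E \<inter> core i) \<inter> H j) * inverse (measure lebesgue (f ` core i)))
      has_sum cell_density i) I" by simp
  moreover have "((\<lambda>j. transition_matrix f H i j * cell_density j)
      has_sum (\<Sum>\<^sub>\<infinity>j\<in>I. transition_matrix f H i j * cell_density j)) I"
    using assms cell_density_bounds by (intro has_sum_infsum summable_row_mult) auto
  moreover have "measure lebesgue (f ` (E \<inter> core i) \<inter> H j) * inverse (measure lebesgue (f ` core i))
      \<le> transition_matrix f H i j * cell_density j" if "j \<in> I" for j
  proof -
    have "measure lebesgue (f ` (E \<inter> core i) \<inter> H j) \<le> cell_density j * measure lebesgue (f ` core i \<inter> H j)"
      using assms that H_lmeasurable[OF that]
      by (intro measure_image_Int_le[where j = j]) (auto simp: cell_density_bounds cell_density_mult)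
    then show ?thesis
      using measure_image_core_pos[OF assms]
      by (simp add: transition_matrix_eq[OF assms that] field_simps)
  qed
  ultimately show ?thesis
    by (rule has_sum_mono)
qed

lemma measure_E_cylinder_le:
  assumes "w \<noteq> []" "set w \<subseteq> I"
  shows "measure lebesgue (E \<inter> cylinder X f H w) \<le> cell_density (last w) * measure lebesgue (cylinder X f H w)"
  using assms
proof (induction w)
  case (Cons i w)
  have i: "i \<in> I" using Cons.prems by auto
  show ?case
  proof (cases "w = []")
    case True
    then show ?thesis by (simp add: cylinder_single cell_density_mult i)
  next
    case False
    define Q where "Q = cylinder X f H w"
    define Y where "Y = core i \<inter> (f -` Q \<inter> X)"
    have Q: "Q \<in> sets lebesgue" "Q \<subseteq> H (hd w)"
      using False Cons.prems by (auto simp: Q_def intro: cylinder_sets dest: cylinder_subset_hd)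
    have hd: "hd w \<in> I" "last w \<in> I"
      using False Cons.prems by auto
    have ih: "measure lebesgue (E \<inter> Q) \<le> cell_density (last w) * measure lebesgue Q"
      unfolding Q_def using Cons False by auto
    have C: "cylinder X f H (i # w) = H i \<inter> (f -` Q \<inter> X)"
      using cylinder_Cons[OF False] by (simp add: Q_def)
    have Y_sets: "Y \<in> sets lebesgue"
      unfolding Y_def using vimage_sets[OF Q(1)] core_sets by (rule sets.Int[rotated])
    have C_sets: "cylinder X f H (i # w) \<in> sets lebesgue"
      by (rule cylinder_sets[OF Cons.prems])
    have edge: "cylinder X f H (i # w) - Y \<subseteq> H i - core i" "Y \<subseteq> cylinder X f H (i # w)"
      using core_subset[of i] by (auto simp: C Y_def)
    have neg: "negligible (S \<inter> cylinder X f H (i # w) - S \<inter> Y)" for S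
      by (rule negligible_subset[OF negligible_finite[OF finite_edge[OF i]]]) (use edge in blast)
    have empty: "S \<inter> Y - S \<inter> cylinder X f H (i # w) = {}" for S
      using edge by blast
    have meas: "measure lebesgue (S \<inter> cylinder X f H (i # w)) = measure lebesgue (S \<inter> Y)"
      if "S \<in> sets lebesgue" for S
      by (rule measure_eq_mod_negligible[OF _ _ neg]) (use that Y_sets C_sets in \<open>auto simp: empty\<close>)
    have img: "f ` (S \<inter> Y) = f ` (S \<inter> core i) \<inter> Q" for S
      using core_subset[of i] H_subset_X[OF i] by (auto simp: Y_def)
    have "\<bar>s i\<bar> * measure lebesgue (E \<inter> Y) = measure lebesgue (f ` (E \<inter> Y))"
      using E_sets Y_sets by (intro image_core(2)[symmetric] i) (auto simp: Y_def)
    also have "\<dots> \<le> cell_density (last w) * measure lebesgue (f ` core i \<inter> Q)"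
      unfolding img using i hd Q ih by (intro measure_image_Int_le[where j = "hd w"]) (auto simp: cell_density_bounds)
    also have "measure lebesgue (f ` core i \<inter> Q) = \<bar>s i\<bar> * measure lebesgue Y"
      using img[of UNIV] Y_sets by (subst image_core(2)[symmetric, OF i]) (auto simp: Y_def)
    finally have "\<bar>s i\<bar> * measure lebesgue (E \<inter> Y) \<le> \<bar>s i\<bar> * (cell_density (last w) * measure lebesgue Y)"
      by (simp add: mult_ac)
    then have "measure lebesgue (E \<inter> Y) \<le> cell_density (last w) * measure lebesgue Y"
      using slope_nonzero[OF i] by simp
    then show ?thesis
      using meas[OF E_sets] meas[of UNIV] False by simp
  qed
qed simp

lemma measure_E_Union_cylinders_le:
  assumes "finite W" "\<And>w. w \<in> W \<Longrightarrow> w \<noteq> [] \<and> set w \<subseteq> I"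
    and q: "\<And>i. i \<in> I \<Longrightarrow> cell_density i \<le> q"
  shows "measure lebesgue (E \<inter> (\<Union>w\<in>W. cylinder X f H w)) \<le> q * measure lebesgue (\<Union>w\<in>W. cylinder X f H w)"
proof -
  define M where "M = {w\<in>W. \<forall>v\<in>W. prefix v w \<longrightarrow> v = w}"
  have M: "finite M" "M \<subseteq> W"
    using assms(1) by (auto simp: M_def)
  have "\<exists>v\<in>M. prefix v w" if "w \<in> W" for w
    using that
  proof (induction w rule: length_induct)
    case (1 w)
    show ?case
    proof (cases "w \<in> M")
      case False
      then obtain v where "v \<in> W" "strict_prefix v w"
        using "1.prems" by (auto simp: M_def strict_prefix_def)
      moreover from this obtain u where "u \<in> M" "prefix u v"
        using "1.IH" prefix_length_less by blast
      ultimately show ?thesis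
        using prefix_order.trans by (auto simp: strict_prefix_def)
    qed auto
  qed
  then have union: "(\<Union>w\<in>W. cylinder X f H w) = (\<Union>w\<in>M. cylinder X f H w)"
    using cylinder_prefix assms(2) M(2) by (intro subset_antisym UN_least) (meson UN_upper subset_trans subsetD)+
  have meas: "cylinder X f H w \<in> lmeasurable" if "w \<in> M" for w
    using assms(2)[of w] that M(2) by (intro cylinder_lmeasurable) auto
  have neg: "negligible (cylinder X f H w \<inter> cylinder X f H v)" if "w \<in> M" "v \<in> M" "w \<noteq> v" for w v
    using that assms(2)[of w] assms(2)[of v] by (intro negligible_cylinder_Int) (auto simp: M_def)
  have "measure lebesgue (E \<inter> (\<Union>w\<in>M. cylinder X f H w))
      = measure lebesgue (\<Union>w\<in>M. E \<inter> cylinder X f H w)"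
    by (simp only: Int_UN_distrib)
  also have "\<dots> = (\<Sum>w\<in>M. measure lebesgue (E \<inter> cylinder X f H w))"
  proof (rule measure_negligible_finite_Union_image)
    show "pairwise (\<lambda>w v. negligible (E \<inter> cylinder X f H w \<inter> (E \<inter> cylinder X f H v))) M"
      unfolding pairwise_def
    proof (intro ballI impI)
      fix w v assume "w \<in> M" "v \<in> M" "w \<noteq> v"
      from neg[OF this] show "negligible (E \<inter> cylinder X f H w \<inter> (E \<inter> cylinder X f H v))"
        by (rule negligible_subset) blast
    qed
  qed (use M(1) meas E_Int_lmeasurable in blast)+
  also have "\<dots> \<le> (\<Sum>w\<in>M. q * measure lebesgue (cylinder X f H w))"
  proof (rule sum_mono)
    fix w assume "w \<in> M"
    then have w: "w \<noteq> []" "set w \<subseteq> I"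
      using M(2) assms(2)[of w] by auto
    then have "last w \<in> I" by auto
    have "measure lebesgue (E \<inter> cylinder X f H w) \<le> cell_density (last w) * measure lebesgue (cylinder X f H w)"
      by (rule measure_E_cylinder_le[OF w])
    also have "\<dots> \<le> q * measure lebesgue (cylinder X f H w)"
      by (intro mult_right_mono q \<open>last w \<in> I\<close>) simp
    finally show "measure lebesgue (E \<inter> cylinder X f H w) \<le> q * measure lebesgue (cylinder X f H w)" .
  qed
  also have "\<dots> = q * (\<Sum>w\<in>M. measure lebesgue (cylinder X f H w))"
    by (simp add: sum_distrib_left)
  also have "(\<Sum>w\<in>M. measure lebesgue (cylinder X f H w)) = measure lebesgue (\<Union>w\<in>M. cylinder X f H w)"
    using M(1) meas neg by (intro measure_negligible_finite_Union_image[symmetric]) (auto simp: pairwise_def)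
  finally show ?thesis
    unfolding union .
qed

lemma measure_E_interval_le:
  assumes "expansive X f H I" "is_interval J" "bounded J" "J \<subseteq> X"
    and q: "0 \<le> q" "q \<le> 1" "\<And>i. i \<in> I \<Longrightarrow> cell_density i \<le> q"
  shows "measure lebesgue (E \<inter> J) \<le> q * measure lebesgue J"
proof (rule field_le_epsilon)
  fix e :: real assume "e > 0"
  then obtain W where W: "finite W" "\<forall>w\<in>W. w \<noteq> [] \<and> set w \<subseteq> I"
    "emeasure lebesgue (sym_diff J (\<Union>w\<in>W. cylinder X f H w)) < ennreal (e / 2)"
    using assms(1-4) unfolding expansive_def by (meson half_gt_zero)
  define U where "U = (\<Union>w\<in>W. cylinder X f H w)"
  have J: "J \<in> lmeasurable"
    using assms(2,3) by (simp add: is_interval_convex_1 measurable_convex)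
  have U: "U \<in> lmeasurable"
    unfolding U_def using W by (intro fmeasurable.finite_UN cylinder_lmeasurable) auto
  define D where "D = sym_diff J U"
  have D: "D \<in> lmeasurable"
    unfolding D_def using J U by (intro fmeasurable.Un fmeasurable.Diff)
  note sets = J[THEN fmeasurableD] U[THEN fmeasurableD] D[THEN fmeasurableD] E_sets
  have small: "measure lebesgue D \<le> e / 2"
    using W(3) D \<open>e > 0\<close> unfolding U_def[symmetric] D_def[symmetric]
    by (simp add: emeasure_eq_measure2 ennreal_less_iff less_imp_le)
  have "measure lebesgue (E \<inter> J) \<le> measure lebesgue (E \<inter> U \<union> D)"
    using E_Int_lmeasurable[OF U] D sets
    by (intro measure_mono_fmeasurable fmeasurable.Un sets.Int) (auto simp: D_def)
  also have "\<dots> \<le> measure lebesgue (E \<inter> U) + measure lebesgue D"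
    using sets by (intro measure_Un_le sets.Int)
  also have "\<dots> \<le> q * measure lebesgue U + e / 2"
    using measure_E_Union_cylinders_le[OF W(1) _ q(3)] W(2) small
    unfolding U_def[symmetric] by (intro add_mono) auto
  also have "q * measure lebesgue U + e / 2 \<le> q * (measure lebesgue J + e / 2) + e / 2"
  proof -
    have "measure lebesgue U \<le> measure lebesgue (J \<union> D)"
      using J D sets by (intro measure_mono_fmeasurable fmeasurable.Un) (auto simp: D_def)
    also have "\<dots> \<le> measure lebesgue J + measure lebesgue D"
      using sets by (intro measure_Un_le)
    finally show ?thesis
      using small q(1) by (intro add_right_mono mult_left_mono) auto
  qed
  also have "\<dots> \<le> q * measure lebesgue J + e"
    using mult_right_mono[OF q(2), of e] \<open>e > 0\<close> by (simp add: field_simps)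
  finally show "measure lebesgue (E \<inter> J) \<le> q * measure lebesgue J + e" .
qed

lemma measure_E_open_le:
  assumes "expansive X f H I" "i \<in> I" "open T" "T \<subseteq> core i"
    and q: "0 \<le> q" "q \<le> 1" "\<And>i. i \<in> I \<Longrightarrow> cell_density i \<le> q"
  shows "measure lebesgue (E \<inter> T) \<le> q * measure lebesgue T"
proof -
  have TH: "T \<subseteq> H i" "T \<subseteq> X"
    using assms(2,4) core_subset H_subset_X by blast+
  have T: "T \<in> lmeasurable"
    using fmeasurableI2[OF H_lmeasurable[OF assms(2)] TH(1)] assms(3) by simp
  have comp: "C \<subseteq> T" "open C" "connected C" if "C \<in> components T" for C
    using that assms(3) by (auto simp: open_components in_components_connected dest: in_components_subset)
  have disj: "pairwise disjnt (components T)"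
    using components_nonoverlap by (auto simp: pairwise_def disjnt_def)
  have count: "countable (components T)"
    using comp disj by (intro countable_disjoint_open_subsets) auto
  have eq: "T = \<Union>(components T)"
    by simp
  have le: "emeasure lebesgue (E \<inter> C) \<le> ennreal q * emeasure lebesgue C" if "C \<in> components T" for C
  proof -
    have C: "C \<in> lmeasurable"
      using fmeasurableI2[OF T comp(1)] comp(2) that by simp
    have "bounded (H i)"
      using nondeg[OF assms(2)] H_lmeasurable[OF assms(2)]
      by (intro bounded_interval_finite_measure) (auto simp: nondeg_closed_interval_def)
    then have "bounded C"
      using comp(1)[OF that] TH(1) bounded_subset by blast
    then have "measure lebesgue (E \<inter> C) \<le> q * measure lebesgue C"
      using comp[OF that] TH(2) by (intro measure_E_interval_le assms q) (auto simp: is_interval_connected_1)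
    then show ?thesis
      using C E_Int_lmeasurable[OF C] q(1)
      by (simp add: emeasure_eq_measure2 ennreal_mult'[symmetric])
  qed
  have meas: "C \<in> sets lebesgue" "E \<inter> C \<in> sets lebesgue" if "C \<in> components T" for C
    using comp(2)[OF that] E_sets by auto
  have "E \<inter> T = (\<Union>C\<in>components T. E \<inter> C)"
    using eq by blast
  then have "emeasure lebesgue (E \<inter> T) = (\<integral>\<^sup>+C. emeasure lebesgue (E \<inter> C) \<partial>count_space (components T))"
    using count disj meas
    by (simp only:) (intro emeasure_UN_countable; force simp: disjoint_family_on_def pairwise_def disjnt_def)
  also have "\<dots> \<le> (\<integral>\<^sup>+C. ennreal q * emeasure lebesgue C \<partial>count_space (components T))"
    using le by (intro nn_integral_mono) auto
  also have "\<dots> = ennreal q * (\<integral>\<^sup>+C. emeasure lebesgue C \<partial>count_space (components T))"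
    by (intro nn_integral_cmult) auto
  also have "(\<integral>\<^sup>+C. emeasure lebesgue C \<partial>count_space (components T)) = emeasure lebesgue (\<Union>C\<in>components T. C)"
    using count disj meas
    by (intro emeasure_UN_countable[symmetric]) (auto simp: disjoint_family_on_def pairwise_def disjnt_def)
  finally have "emeasure lebesgue (E \<inter> T) \<le> ennreal q * emeasure lebesgue T"
    by simp
  then show ?thesis
    using T E_Int_lmeasurable[OF T] q(1)
    by (simp add: emeasure_eq_measure2 ennreal_mult'[symmetric])
qed

lemma measure_E_cell_eq_0:
  assumes "expansive X f H I" "i \<in> I"
    and q: "0 \<le> q" "q < 1" "\<And>i. i \<in> I \<Longrightarrow> cell_density i \<le> q"
  shows "measure lebesgue (E \<inter> H i) = 0"
proof -
  define m where "m = measure lebesgue (E \<inter> core i)"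
  have E: "E \<inter> core i \<in> lmeasurable"
    by (rule E_Int_lmeasurable[OF core_lmeasurable[OF assms(2)]])
  have "m \<le> q * m + e" if e: "e > 0" for e
  proof -
    obtain T where T: "open T" "E \<inter> core i \<subseteq> T" "T - E \<inter> core i \<in> lmeasurable"
      "emeasure lebesgue (T - E \<inter> core i) < ennreal e"
      using sets_lebesgue_outer_open[OF fmeasurableD[OF E] e] by blast
    define V where "V = T \<inter> core i"
    have "measure lebesgue (T - E \<inter> core i) \<le> e"
      using T(3,4) e by (simp add: emeasure_eq_measure2 ennreal_less_iff less_imp_le)
    moreover have V: "open V" "V \<subseteq> core i" "E \<inter> V = E \<inter> core i"
      using T(1,2) by (auto simp: V_def)
    have "measure lebesgue V \<le> measure lebesgue (E \<inter> core i \<union> (T - E \<inter> core i))"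
      using E T(3) V(1) by (intro measure_mono_fmeasurable fmeasurable.Un) (auto simp: V_def)
    moreover have "\<dots> \<le> m + measure lebesgue (T - E \<inter> core i)"
      unfolding m_def using E T(3) by (intro measure_Un_le) (auto dest: fmeasurableD)
    moreover have "m \<le> q * measure lebesgue V"
      unfolding m_def V(3)[symmetric]
      using assms(1,2) V(1,2) q by (intro measure_E_open_le) auto
    ultimately have "m \<le> q * (m + e)"
      using mult_left_mono[of "measure lebesgue V" "m + e" q] q(1) by linarith
    also have "\<dots> \<le> q * m + e"
      using mult_right_mono[of q 1 e] q(2) e by (simp add: algebra_simps)
    finally show ?thesis .
  qed
  then have "m \<le> q * m"
    by (rule field_le_epsilon)
  then have "(1 - q) * m \<le> 0" by (simp add: algebra_simps)
  then have "m = 0"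
    using q(2) measure_nonneg[of lebesgue "E \<inter> core i"] unfolding m_def[symmetric]
    by (simp add: mult_le_0_iff)
  then show ?thesis
    by (simp add: m_def measure_E_core assms(2))
qed

lemma null_or_full:
  assumes "expansive X f H I" "irreducible_chain I (transition_matrix f H)"
    and "positive_recurrent_chain I (transition_matrix f H)"
  shows "negligible E \<or> negligible (X - E)"
proof -
  interpret stochastic_matrix I "transition_matrix f H"
    by (rule stochastic_transition_matrix)
  have const: "cell_density i = cell_density j" if "i \<in> I" "j \<in> I" for i j
  proof (rule subharmonic_constant[where d = cell_density, OF assms(2) _ _ _ that])
    show "(\<lambda>n. first_passage I (transition_matrix f H) n i i) sums 1" if "i \<in> I" for i
      using assms(3) that by (auto simp: positive_recurrent_chain_def)
    show "0 \<le> cell_density i \<and> cell_density i \<le> 1" if "i \<in> I" for i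
      using cell_density_bounds[OF that] by simp
  qed (rule cell_density_subharmonic)
  show ?thesis
  proof (cases "\<exists>i\<in>I. cell_density i < 1")
    case True
    then obtain i where i: "i \<in> I" "cell_density i < 1" by blast
    have "negligible (E \<inter> H j)" if "j \<in> I" for j
    proof -
      have "measure lebesgue (E \<inter> H j) = 0"
        by (rule measure_E_cell_eq_0[OF assms(1) that cell_density_bounds(1)[OF i(1)] i(2)])
          (rule eq_refl[OF const[OF _ i(1)]])
      then show ?thesis
        using E_Int_lmeasurable[OF H_lmeasurable[OF that]] by (simp add: negligible_iff_measure)
    qed
    then have "negligible (\<Union>j\<in>I. E \<inter> H j)"
      by (intro negligible_countable_Union) auto
    moreover have "(\<Union>j\<in>I. E \<inter> H j) = E"
      using E_subset by (auto simp: X_eq)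
    ultimately show ?thesis by simp
  next
    case False
    have "negligible (H j - E)" if "j \<in> I" for j
    proof -
      have "cell_density j = 1"
        using False cell_density_bounds[OF that] that by fastforce
      then have "measure lebesgue (H j) = measure lebesgue (E \<inter> H j)"
        using cell_density_mult[OF that] by simp
      moreover have "measure lebesgue (H j - E \<inter> H j) = measure lebesgue (H j) - measure lebesgue (E \<inter> H j)"
        using H_lmeasurable[OF that] E_Int_lmeasurable[OF H_lmeasurable[OF that]]
        by (intro measurable_measure_Diff fmeasurableD) auto
      ultimately have "negligible (H j - E \<inter> H j)"
        using fmeasurable.Diff[OF H_lmeasurable[OF that] E_Int_lmeasurable[OF H_lmeasurable[OF that]]]
        by (metis diff_self negligible_iff_measure)
      moreover have "H j - E \<inter> H j = H j - E" by blast
      ultimately show ?thesis by simp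
    qed
    then have "negligible (\<Union>j\<in>I. H j - E)"
      by (intro negligible_countable_Union) auto
    moreover have "(\<Union>j\<in>I. H j - E) = X - E"
      by (auto simp: X_eq)
    ultimately show ?thesis by simp
  qed
qed

end

theorem theorem5p6:
  fixes X E :: "real set" and f :: "real \<Rightarrow> real"
    and \<H> :: "real set set" and H :: "nat \<Rightarrow> real set" and I :: "nat set"
  assumes "interval_system X f"
    and "l_markov_partition X f \<H>"
    and "enumerates H I \<H>"
    and "expansive X f H I"
    and "\<forall>i\<in>I. emeasure lebesgue (H i) < \<infinity>"
    and "irreducible_chain I (transition_matrix f H)"
    and "aperiodic_chain I (transition_matrix f H)"
    and "positive_recurrent_chain I (transition_matrix f H)"
    and "E \<in> sets (lebesgue_on X)"
    and "emeasure lebesgue (f ` E - E) = 0"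
  shows "emeasure lebesgue E = 0 \<or> emeasure lebesgue (X - E) = 0"
proof -
  interpret markov_system X f \<H> H I
    by (rule markov_system.intro) (use assms(1-3,5) in blast)+
  have E: "E \<in> sets lebesgue" "E \<subseteq> X"
    using assms(9) X_sets by (auto simp: sets_restrict_space_iff)
  define N where "N = (\<Union>i\<in>I. E \<inter> (H i - core i))"
  have "E = (\<Union>i\<in>I. E \<inter> core i) \<union> N"
    unfolding N_def using E(2) X_eq core_subset by blast
  then have eq: "f ` E = (\<Union>i\<in>I. f ` (E \<inter> core i)) \<union> f ` N"
    by (metis image_UN image_Un)
  have "f ` (E \<inter> core i) \<in> sets lebesgue" if "i \<in> I" for i
    by (intro fmeasurableD image_core(1)[OF that] sets.Int core_sets E(1); blast)
  then have "(\<Union>i\<in>I. f ` (E \<inter> core i)) \<in> sets lebesgue"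
    by (intro sets.countable_UN') auto
  moreover have "countable (f ` N)"
    unfolding N_def by (intro countable_image countable_subset[OF _ countable_edges]) blast
  then have "f ` N \<in> sets lebesgue"
    using negligible_countable negligible_imp_sets by blast
  ultimately have "f ` E \<in> sets lebesgue"
    unfolding eq by (rule sets.Un)
  then have "negligible (f ` E - E)"
    using sets.Diff[OF _ E(1)] assms(10) unfolding negligible_iff_null_sets by (intro null_setsI)
  then interpret forward_invariant_set X f \<H> H I E
    by (intro forward_invariant_set.intro markov_system_axioms forward_invariant_set_axioms.intro E)
  show ?thesis
    using null_or_full[OF assms(4,6,8)] null_setsD1 unfolding negligible_iff_null_sets by blast
qed

end
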